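(* Let $n$ be a positive integer. The total number of non-root records, summed over all rooted trees with vertex set $[n]$, equals $\gamma_n$, where $\gamma_n$ is $\frac1n$ times the sum, over all rooted trees with vertex set $[n]$, of the total height of the tree.
   Context: All trees are labeled; a rooted tree on $[n]$ has vertex set $[n]=\{1,\dots,n\}$ and a distinguished root. A node $v$ is a record if its label is the largest on the path from $v$ to the root (inclusive); the root is always a record. The height of a node is the number of edges on its path to the root, and the total height of a tree is the sum of the heights of its nodes. The sequence $(\gamma_n)$ is the "normalized total height of all nodes in all rooted trees with $n$ labeled nodes" (OEIS A000435). *)

theory Defs
  imports Complex_Main "Graph_Theory.Graph_Theory"
begin

text \<open>
  A simple undirected graph is modelled as a \<^locale>\<open>pair_graph\<close>: every edge \<open>{u, v}\<close> is the
  pair of arcs \<open>(u, v)\<close> and \<open>(v, u)\<close>. Traversing an edge back and forth is then a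
  \<^const>\<open>pre_digraph.cycle\<close> of length 2, so \<^const>\<open>tree\<close> and \<^const>\<open>forest\<close>, meant for
  directed graphs, fail as soon as there is an edge. A cycle of the undirected graph is a
  directed cycle of length at least 3.
\<close>

definition undirected_tree :: "'a pair_pre_digraph \<Rightarrow> bool" where
  "undirected_tree T \<longleftrightarrow> pair_graph T \<and> connected (with_proj T) \<and>
     \<not> (\<exists>p. pre_digraph.cycle (with_proj T) p \<and> 3 \<le> length p)"

definition rooted_trees :: "nat \<Rightarrow> (nat pair_pre_digraph \<times> nat) set" where
  "rooted_trees n = {(T, r). undirected_tree T \<and> pverts T = {1..n} \<and> r \<in> pverts T}"

text \<open>In a tree there is exactly one path between any two vertices; it is given as a list of arcs.\<close>

definition tree_path :: "'a pair_pre_digraph \<Rightarrow> 'a \<Rightarrow> 'a \<Rightarrow> ('a \<times> 'a) list" where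
  "tree_path T u v = (THE p. pre_digraph.apath (with_proj T) u p v)"

definition height :: "'a pair_pre_digraph \<Rightarrow> 'a \<Rightarrow> 'a \<Rightarrow> nat" where
  "height T r v = length (tree_path T v r)"

definition total_height :: "'a pair_pre_digraph \<Rightarrow> 'a \<Rightarrow> nat" where
  "total_height T r = (\<Sum>v\<in>pverts T. height T r v)"

definition is_record :: "'a::linorder pair_pre_digraph \<Rightarrow> 'a \<Rightarrow> 'a \<Rightarrow> bool" where
  "is_record T r v \<longleftrightarrow> v \<in> pverts T \<and>
     (\<forall>u\<in>set (pre_digraph.awalk_verts (with_proj T) v (tree_path T v r)). u \<le> v)"

definition nonroot_records :: "'a::linorder pair_pre_digraph \<Rightarrow> 'a \<Rightarrow> 'a set" where
  "nonroot_records T r = {v. is_record T r v \<and> v \<noteq> r}"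

definition normalized_total_height :: "nat \<Rightarrow> real" where
  "normalized_total_height n = (1 / real n) * real (\<Sum>(T, r)\<in>rooted_trees n. total_height T r)"

end

theory Submission
  imports Defs "HOL-Combinatorics.Multiset_Permutations"
begin

text \<open>
  Cutting the edges of the path from a vertex to the root turns a rooted tree with a marked vertex
  into a rooted forest together with a linear order of its roots. Let \<open>f\<close> denote the number of
  roots, let sums range over all rooted forests on the \<open>n\<close> labels, and let \<open>t\<close> be the number of
  rooted trees. The cut gives \<open>n * t = \<Sum> f!\<close>, total height \<open>\<Sum> (f - 1) * f!\<close>, and,
  since a record is a marked vertex whose label is the maximum of the cut path, \<open>\<Sum> (f - 1)!\<close>
  records including the \<open>t\<close> roots. Pitman's double counting (hang a root below a vertex of another
  tree) yields \<open>\<Sum> n * (f - 1) * w f = \<Sum> (n - f) * w (f + 1)\<close> for every weight \<open>w\<close>;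
  with \<open>w f = (f - 1)!\<close> this is \<open>n * \<Sum> (f - 1)! = \<Sum> f * f!\<close>, and subtracting
  \<open>n * t = \<Sum> f!\<close> proves the claim.
\<close>

subsection \<open>Rooted forests as parent maps\<close>

text \<open>Since the predicate is inductive, a branch certifies that iterating \<open>p\<close>
  from \<open>x\<close> stops at a fixed point. Requiring a branch for every vertex thus rules out
  cycles of length at least 2.\<close>

inductive branch :: "('a \<Rightarrow> 'a) \<Rightarrow> 'a \<Rightarrow> 'a list \<Rightarrow> bool" for p where
  root: "p x = x \<Longrightarrow> branch p x [x]"
| step: "p x \<noteq> x \<Longrightarrow> branch p (p x) xs \<Longrightarrow> branch p x (x # xs)"

lemma branch_root_iff: "p x = x \<Longrightarrow> branch p x xs \<longleftrightarrow> xs = [x]"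
  by (subst branch.simps) auto

lemma branch_unique:
  assumes "branch p x xs" "branch p x ys"
  shows "xs = ys"
  using assms
proof (induction arbitrary: ys rule: branch.induct)
  case (root x)
  then show ?case by (simp add: branch_root_iff)
next
  case (step x xs)
  from \<open>branch p x ys\<close> show ?case
    by cases (simp_all add: step.hyps(1), metis step.IH)
qed

lemma branch_Cons: "branch p x xs \<Longrightarrow> \<exists>ys. xs = x # ys"
  by (subst (asm) branch.simps) auto

lemma branch_nonempty: "branch p x xs \<Longrightarrow> xs \<noteq> []"
  by (auto dest: branch_Cons)

lemma hd_branch: "branch p x xs \<Longrightarrow> hd xs = x"
  by (auto dest: branch_Cons)

text \<open>The length bound is the point: if a vertex recurred on its own branch, it would have a
  second, shorter branch, against uniqueness.\<close>

lemma branch_suffix: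
  assumes "branch p x xs" "y \<in> set xs"
  shows "\<exists>ys. branch p y ys \<and> length ys \<le> length xs"
  using assms
proof (induction rule: branch.induct)
  case (root x)
  then show ?case by (auto intro: branch.root)
next
  case (step x xs)
  show ?case
  proof (cases "y = x")
    case True
    then show ?thesis using branch.step[OF step.hyps] by auto
  next
    case False
    then show ?thesis using step by (auto simp: le_Suc_eq)
  qed
qed

lemma distinct_branch: "branch p x xs \<Longrightarrow> distinct xs"
proof (induction rule: branch.induct)
  case (step x xs)
  have "x \<notin> set xs"
  proof
    assume "x \<in> set xs"
    then obtain ys where "branch p x ys" "length ys \<le> length xs"
      using branch_suffix[OF step.hyps(2)] by blast
    with branch_unique[OF branch.step[OF step.hyps] this(1)] show False
      by auto
  qed
  with step.IH show ?case by simp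
qed simp

lemma last_branch_fixed: "branch p x xs \<Longrightarrow> p (last xs) = last xs"
  by (induction rule: branch.induct) (auto dest: branch_nonempty)

lemma fixed_on_branch:
  assumes "branch p x xs" "y \<in> set xs" "p y = y"
  shows "y = last xs"
  using assms by (induction rule: branch.induct) (auto dest: branch_nonempty)

lemma branch_subset:
  assumes "branch p x xs" "x \<in> V" "\<And>y. y \<in> V \<Longrightarrow> p y \<in> V"
  shows "set xs \<subseteq> V"
  using assms by (induction rule: branch.induct) auto

lemma branch_fun_upd:
  assumes "branch p x xs" "s \<notin> set xs"
  shows "branch (p(s := y)) x xs"
  using assms
proof (induction rule: branch.induct)
  case (root x)
  then show ?case by (intro branch.root) simp
next
  case (step x xs)
  then show ?case by (intro branch.step) auto
qed

lemma ex_branch_step: "branch p (p x) xs \<Longrightarrow> \<exists>ys. branch p x ys"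
  by (cases "p x = x") (auto dest: branch.step)

text \<open>The old branch is followed until it first meets \<open>A\<close>, whose elements are
  fixed by the cut map.\<close>

lemma branch_cut:
  assumes "branch p x xs"
  shows "\<exists>ys. branch (\<lambda>y. if y \<in> A then y else p y) x ys" (is "\<exists>ys. branch ?q x ys")
  using assms
proof (induction rule: branch.induct)
  case (root x)
  then have "?q x = x" by simp
  then show ?case by (intro exI) (rule branch.root)
next
  case (step x xs)
  show ?case
  proof (cases "x \<in> A")
    case True
    then have "?q x = x" by simp
    then show ?thesis by (intro exI) (rule branch.root)
  next
    case False
    from step.IH obtain ys where "branch ?q (p x) ys" ..
    with False have "branch ?q (?q x) ys" by simp
    then show ?thesis by (rule ex_branch_step)
  qed
qed

text \<open>Old branches that avoid \<open>s\<close> persist, and one that reaches \<open>s\<close>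
  continues along \<open>zs\<close>. To see that redirecting \<open>s\<close> creates no cycle, it
  is therefore enough to check the new parent \<open>z\<close>.\<close>

lemma branch_graft:
  assumes "branch p x xs" "branch (p(s := z)) z zs"
  shows "\<exists>ys. branch (p(s := z)) x ys" (is "\<exists>ys. branch ?q x ys")
  using assms(1)
proof (induction rule: branch.induct)
  case (root x)
  show ?case
  proof (cases "x = s")
    case True
    with assms(2) have "branch ?q (?q x) zs" by simp
    then show ?thesis by (rule ex_branch_step)
  next
    case False
    with root have "?q x = x" by simp
    then show ?thesis by (intro exI) (rule branch.root)
  qed
next
  case (step x xs)
  then obtain ys where "branch ?q (p x) ys" by blast
  with assms(2) have "branch ?q (?q x) (if x = s then zs else ys)" by simp
  then show ?case by (rule ex_branch_step)
qed

text \<open>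
  A rooted forest on \<open>V\<close> is encoded by its parent map: roots are the fixed points in \<open>V\<close>, and
  the map is the identity outside \<open>V\<close> so that distinct forests are distinct functions.
\<close>

definition parent_forests :: "'a set \<Rightarrow> ('a \<Rightarrow> 'a) set" where
  "parent_forests V =
     {p. (\<forall>x. x \<notin> V \<longrightarrow> p x = x) \<and> (\<forall>x\<in>V. p x \<in> V \<and> (\<exists>xs. branch p x xs))}"

definition roots :: "'a set \<Rightarrow> ('a \<Rightarrow> 'a) \<Rightarrow> 'a set" where
  "roots V p = {x \<in> V. p x = x}"

definition branch_of :: "('a \<Rightarrow> 'a) \<Rightarrow> 'a \<Rightarrow> 'a list" where
  "branch_of p x = (THE xs. branch p x xs)"

lemma branch_of_eq: "branch p x xs \<Longrightarrow> branch_of p x = xs"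
  unfolding branch_of_def by (blast intro: the_equality branch_unique)

lemma branch_branch_of:
  assumes "p \<in> parent_forests V"
  shows "branch p x (branch_of p x)"
proof -
  have "\<exists>xs. branch p x xs"
    using assms by (cases "x \<in> V") (auto simp: parent_forests_def intro: branch.root)
  then show ?thesis by (auto simp: branch_of_eq)
qed

text \<open>Being the identity outside \<open>V\<close>, a parent map is determined by its
  restriction, an element of a finite function space.\<close>

lemma finite_parent_forests:
  assumes "finite V"
  shows "finite (parent_forests V)"
proof (rule finite_imageD)
  show "inj_on (\<lambda>p. restrict p V) (parent_forests V)"
  proof (rule inj_onI)
    fix p q assume *: "p \<in> parent_forests V" "q \<in> parent_forests V" "restrict p V = restrict q V"
    show "p = q"
    proof
      fix x show "p x = q x"
        using * by (cases "x \<in> V") (auto simp: parent_forests_def dest: fun_cong[of _ _ x])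
    qed
  qed
  have "(\<lambda>p. restrict p V) ` parent_forests V \<subseteq> (\<Pi>\<^sub>E x\<in>V. V)"
    by (auto simp: parent_forests_def)
  then show "finite ((\<lambda>p. restrict p V) ` parent_forests V)"
    by (rule finite_subset) (simp add: finite_PiE assms)
qed

lemma last_branch_of_root:
  assumes "p \<in> parent_forests V" "x \<in> V"
  shows "last (branch_of p x) \<in> roots V p"
proof -
  note b = branch_branch_of[OF assms(1), of x]
  have "set (branch_of p x) \<subseteq> V"
    by (rule branch_subset[OF b assms(2)]) (use assms(1) in \<open>auto simp: parent_forests_def\<close>)
  then show ?thesis
    using last_branch_fixed[OF b] last_in_set[OF branch_nonempty[OF b]]
    by (auto simp: roots_def)
qed

text \<open>A cycle could arise only if \<open>x\<close> lay in the tree of \<open>s\<close>. As the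
  tree of \<open>x\<close> has another root, \<open>s\<close> is not on the branch of
  \<open>x\<close>, and this branch survives the graft.\<close>

lemma graft_in_parent_forests:
  assumes "p \<in> parent_forests V" "s \<in> roots V p" "x \<in> V" "last (branch_of p x) \<noteq> s"
  shows "p(s := x) \<in> parent_forests V" "roots V (p(s := x)) = roots V p - {s}"
proof -
  note b = branch_branch_of[OF assms(1), of x]
  have "s \<notin> set (branch_of p x)"
    using fixed_on_branch[OF b] assms(2,4) by (auto simp: roots_def)
  then have b': "branch (p(s := x)) x (branch_of p x)" and "x \<noteq> s"
    using branch_fun_upd[OF b] branch_Cons[OF b] by auto
  have "\<exists>ys. branch (p(s := x)) y ys" for y
    using branch_graft[OF branch_branch_of[OF assms(1)] b'] .
  then show "p(s := x) \<in> parent_forests V"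
    using assms by (auto simp: parent_forests_def roots_def)
  show "roots V (p(s := x)) = roots V p - {s}"
    using assms \<open>x \<noteq> s\<close> by (auto simp: roots_def)
qed

lemma cut_in_parent_forests:
  assumes "p \<in> parent_forests V" "A \<subseteq> V"
  shows "(\<lambda>y. if y \<in> A then y else p y) \<in> parent_forests V"
    "roots V (\<lambda>y. if y \<in> A then y else p y) = roots V p \<union> A"
proof -
  show "(\<lambda>y. if y \<in> A then y else p y) \<in> parent_forests V"
    using assms branch_cut[OF branch_branch_of[OF assms(1)], of A]
    by (auto simp: parent_forests_def)
  show "roots V (\<lambda>y. if y \<in> A then y else p y) = roots V p \<union> A"
    using assms by (auto simp: roots_def)
qed

lemma cut_point_in_parent_forests:
  assumes "p \<in> parent_forests V" "s \<in> V"
  shows "p(s := s) \<in> parent_forests V" "roots V (p(s := s)) = insert s (roots V p)"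
proof -
  have *: "(\<lambda>y. if y \<in> {s} then y else p y) = p(s := s)"
    by (simp add: fun_eq_iff)
  show "p(s := s) \<in> parent_forests V" "roots V (p(s := s)) = insert s (roots V p)"
    using cut_in_parent_forests[OF assms(1), of "{s}"] assms(2) unfolding * by simp_all
qed

text \<open>
  Pitman's double counting: triples of a forest, a root \<open>s\<close> and a vertex \<open>x\<close> outside the tree of
  \<open>s\<close> correspond, by hanging \<open>s\<close> below \<open>x\<close>, to forests with a distinguished non-root \<open>s\<close>.
\<close>

lemma sum_graft:
  fixes w :: "nat \<Rightarrow> 'b::comm_semiring_1"
  assumes fin: "finite V"
  shows "(\<Sum>p\<in>parent_forests V. of_nat (card V * (card (roots V p) - 1)) * w (card (roots V p)))
    = (\<Sum>p\<in>parent_forests V. of_nat (card V - card (roots V p)) * w (Suc (card (roots V p))))"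
proof -
  let ?F = "parent_forests V"
  let ?w = "\<lambda>p. w (card (roots V p))"
  note finF = finite_parent_forests[OF fin]
  have finr: "finite (roots V p)" for p
    using fin by (simp add: roots_def)
  have "(\<Sum>p\<in>?F. of_nat (card V * (card (roots V p) - 1)) * ?w p)
      = (\<Sum>p\<in>?F. \<Sum>x\<in>V. \<Sum>s\<in>roots V p - {last (branch_of p x)}. ?w p)"
    \<comment> \<open>Each \<open>x\<close> forbids exactly one root, that of its own tree, so
      \<open>s\<close> has one choice fewer than there are roots.\<close>
    by (intro sum.cong refl) (simp add: last_branch_of_root finr card_Diff_singleton mult.assoc)
  also have "\<dots> = (\<Sum>(p, x, s)\<in>Sigma ?F (\<lambda>p. Sigma V (\<lambda>x. roots V p - {last (branch_of p x)})). ?w p)"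
    using finr fin finF
    by (subst sum.Sigma[symmetric], simp, simp, intro sum.cong refl, subst sum.Sigma[symmetric]) auto
  also have "\<dots> = (\<Sum>(p, s)\<in>Sigma ?F (\<lambda>p. V - roots V p). w (Suc (card (roots V p))))"
  \<comment> \<open>After the graft, \<open>x\<close> is read off as the parent of \<open>s\<close>.
    The graft loses one root, which accounts for the \<open>Suc\<close> in the weight.\<close>
  proof (rule sum.reindex_bij_witness[where j = "\<lambda>(p, x, s). (p(s := x), s)"
        and i = "\<lambda>(p, s). (p(s := s), p s, s)"], goal_cases)
    case (1 a)
    then show ?case by (auto simp: roots_def fun_eq_iff)
  next
    case (2 a)
    then obtain p x s where a: "a = (p, x, s)" "p \<in> ?F" "x \<in> V" "s \<in> roots V p"
      "last (branch_of p x) \<noteq> s" by auto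
    with graft_in_parent_forests[of p V s x] show ?case
      by (auto simp: roots_def)
  next
    case (3 b)
    then show ?case by auto
  next
    case (4 b)
    then obtain p s where b: "b = (p, s)" "p \<in> ?F" "s \<in> V" "p s \<noteq> s"
      by (auto simp: roots_def)
    then have ps: "p s \<in> V" by (auto simp: parent_forests_def)
    note br = branch_branch_of[OF b(2)]
    \<comment> \<open>Cutting above \<open>s\<close> leaves the branch of its former parent intact,
      because \<open>s\<close> is not on it; so hanging \<open>s\<close> back there is an admissible
      graft.\<close>
    have "branch_of p s = s # branch_of p (p s)"
      by (intro branch_of_eq branch.step b br)
    then have "s \<notin> set (branch_of p (p s))"
      using distinct_branch[OF br, of s] by simp
    then have same: "branch_of (p(s := s)) (p s) = branch_of p (p s)"
      by (intro branch_of_eq branch_fun_upd br)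
    have "last (branch_of p (p s)) \<noteq> s"
      using \<open>s \<notin> set _\<close> last_in_set[OF branch_nonempty[OF br], of "p s"] by metis
    then have "s \<in> roots V (p(s := s)) - {last (branch_of (p(s := s)) (p s))}"
      unfolding same cut_point_in_parent_forests(2)[OF b(2,3)]
      by (metis Diff_iff insertI1 singletonD)
    with cut_point_in_parent_forests(1)[OF b(2,3)] ps show ?case
      by (simp only: b(1) prod.case mem_Sigma_iff)
  next
    case (5 a)
    then obtain p x s where a: "a = (p, x, s)" "p \<in> ?F" "x \<in> V" "s \<in> roots V p"
      "last (branch_of p x) \<noteq> s" by auto
    then have "Suc (card (roots V (p(s := x)))) = card (roots V p)"
      using finr by (simp add: graft_in_parent_forests card_Suc_Diff1 del: card_Diff_insert card_Diff_singleton)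
    then show ?case using a by simp
  qed
  also have "\<dots> = (\<Sum>p\<in>?F. of_nat (card V - card (roots V p)) * w (Suc (card (roots V p))))"
  proof -
    have "card (V - roots V p) = card V - card (roots V p)" for p
      using finr by (intro card_Diff_subset) (auto simp: roots_def)
    then show ?thesis using finF fin by (subst sum.Sigma[symmetric]) auto
  qed
  finally show ?thesis .
qed

subsection \<open>Cutting the path to the root\<close>

text \<open>The inverse of cutting a path: a list of roots is strung together again, and its last
  entry keeps its value under \<open>q\<close>.\<close>

fun link :: "('a \<Rightarrow> 'a) \<Rightarrow> 'a list \<Rightarrow> 'a \<Rightarrow> 'a" where
  "link q (x # y # zs) = (link q (y # zs))(x := y)"
| "link q _ = q"

lemma link_other: "x \<notin> set xs \<Longrightarrow> link q xs x = q x"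
  by (induction q xs rule: link.induct) auto

text \<open>On a branch the next entry is the parent, so linking restores \<open>p\<close> there.
  Linking does not touch the last entry, hence \<open>q\<close> has to fix it as \<open>p\<close>
  does.\<close>

lemma link_branch:
  assumes "branch p x xs" "q (last xs) = last xs"
  shows "link q xs y = (if y \<in> set xs then p y else q y)"
  using assms
proof (induction arbitrary: y rule: branch.induct)
  case (root x)
  then show ?case by simp
next
  case (step x xs)
  obtain zs where xs: "xs = p x # zs"
    using branch_Cons[OF step.hyps(2)] by blast
  with step.IH[of y] step.prems show ?case by auto
qed

text \<open>Distinctness keeps the later entries unaffected when the head is redirected, and keeps
  neighbouring entries different, as \<open>branch\<close> demands.\<close>

lemma branch_link:
  assumes "xs \<noteq> []" "distinct xs" "q (last xs) = last xs"
  shows "branch (link q xs) (hd xs) xs"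
  using assms
proof (induction q xs rule: link.induct)
  case (1 q x y zs)
  let ?p = "link q (x # y # zs)"
  from 1 have "branch (link q (y # zs)) y (y # zs)" by simp
  moreover have "x \<notin> set (y # zs)" using "1.prems" by simp
  ultimately have "branch ((link q (y # zs))(x := y)) y (y # zs)"
    by (rule branch_fun_upd)
  moreover have "?p x = y" "y \<noteq> x" using "1.prems" by auto
  ultimately have "branch ?p x (x # y # zs)"
    by (intro branch.step) (simp_all only: link.simps not_False_eq_True)
  then show ?case by (simp only: list.sel)
qed (auto intro: branch.root)

text \<open>The roots are grafted one at a time from the end of the list; only the last entry stays
  a root, whence \<open>butlast\<close>.\<close>

lemma link_in_parent_forests:
  assumes "q \<in> parent_forests V" "xs \<noteq> []" "distinct xs" "set xs \<subseteq> roots V q"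
  shows "link q xs \<in> parent_forests V \<and> roots V (link q xs) = roots V q - set (butlast xs)"
  using assms
proof (induction q xs rule: link.induct)
  case (1 q x y zs)
  let ?p = "link q (y # zs)"
  have p: "?p \<in> parent_forests V" "roots V ?p = roots V q - set (butlast (y # zs))"
    using 1 by auto
  have x: "x \<in> roots V ?p"
    using "1.prems" p(2) by (auto dest: in_set_butlastD)
  have "q (last (y # zs)) = last (y # zs)"
    using "1.prems"(4) last_in_set[of "y # zs"] by (auto simp: roots_def)
  \<comment> \<open>The part already linked is the branch of \<open>y\<close>. It ends in a root
    other than \<open>x\<close>, so \<open>x\<close> may be hung below \<open>y\<close>.\<close>
  then have y: "branch_of ?p y = y # zs"
    using branch_link[of "y # zs" q] "1.prems" by (intro branch_of_eq) simp
  have "last (y # zs) \<noteq> x"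
    using "1.prems"(3) last_in_set[of "y # zs"] by auto
  then have last: "last (branch_of ?p y) \<noteq> x"
    unfolding y .
  have "y \<in> V" using "1.prems" by (auto simp: roots_def)
  have "set (butlast (x # y # zs)) = insert x (set (butlast (y # zs)))" by simp
  with graft_in_parent_forests[OF p(1) x \<open>y \<in> V\<close> last] p(2) show ?case
    unfolding link.simps by blast
qed auto

definition parent_trees :: "'a set \<Rightarrow> ('a \<Rightarrow> 'a) set" where
  "parent_trees V = {p \<in> parent_forests V. card (roots V p) = 1}"

lemma parent_trees_roots:
  assumes "p \<in> parent_trees V" "x \<in> V"
  shows "roots V p = {last (branch_of p x)}"
proof -
  obtain r where "roots V p = {r}"
    using assms(1) by (auto simp: parent_trees_def card_1_singleton_iff)
  moreover have "last (branch_of p x) \<in> roots V p"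
    using assms by (intro last_branch_of_root) (simp_all add: parent_trees_def)
  ultimately show ?thesis by simp
qed

text \<open>
  Deleting the edges of the path from a vertex to the root leaves a forest whose roots are the
  vertices of the path, listed in path order.
\<close>

lemma sum_branches:
  fixes h :: "'a list \<Rightarrow> 'b::comm_monoid_add"
  assumes fin: "finite V" and ne: "V \<noteq> {}"
  shows "(\<Sum>p\<in>parent_trees V. \<Sum>x\<in>V. h (branch_of p x))
    = (\<Sum>q\<in>parent_forests V. \<Sum>xs\<in>permutations_of_set (roots V q). h xs)"
proof -
  let ?cut = "\<lambda>p xs y. if y \<in> set xs then y else p y"
  let ?F = "parent_forests V"
  note finF = finite_parent_forests[OF fin]
  have "(\<Sum>p\<in>parent_trees V. \<Sum>x\<in>V. h (branch_of p x))
      = (\<Sum>(p, x)\<in>parent_trees V \<times> V. h (branch_of p x))"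
    by (simp add: sum.cartesian_product)
  also have "\<dots> = (\<Sum>(q, xs)\<in>Sigma ?F (\<lambda>q. permutations_of_set (roots V q)). h xs)"
  \<comment> \<open>The list keeps both the deleted edges, as its consecutive pairs, and the marked
    vertex, as its head.\<close>
  proof (rule sum.reindex_bij_witness[where
        j = "\<lambda>(p, x). (?cut p (branch_of p x), branch_of p x)" and
        i = "\<lambda>(q, xs). (link q xs, hd xs)"], goal_cases)
    case (1 a)
    then obtain p x where a: "a = (p, x)" "p \<in> ?F" by (auto simp: parent_trees_def)
    note br = branch_branch_of[OF a(2), of x]
    show ?case
      using link_branch[OF br, of "?cut p (branch_of p x)"] hd_branch[OF br]
        last_in_set[OF branch_nonempty[OF br]]
      by (auto simp: a fun_eq_iff)
  next
    case (2 a)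
    then obtain p x where a: "a = (p, x)" "p \<in> ?F" "x \<in> V" "p \<in> parent_trees V"
      by (auto simp: parent_trees_def)
    note br = branch_branch_of[OF a(2), of x]
    have sub: "set (branch_of p x) \<subseteq> V"
      by (rule branch_subset[OF br a(3)]) (use a(2) in \<open>auto simp: parent_forests_def\<close>)
    \<comment> \<open>The only root of the tree ends the branch, so the roots after the cut are
      exactly the vertices of the branch.\<close>
    have "roots V p \<subseteq> set (branch_of p x)"
      using parent_trees_roots[OF a(4,3)] last_in_set[OF branch_nonempty[OF br]] by simp
    then show ?case
      using cut_in_parent_forests[OF a(2) sub] distinct_branch[OF br]
      by (auto simp: a permutations_of_set_def)
  next
    case (3 b)
    then obtain q xs where b: "b = (q, xs)" "q \<in> ?F" "set xs = roots V q" "distinct xs"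
      by (auto simp: permutations_of_set_def)
    obtain x where "x \<in> V" using ne by blast
    then have "xs \<noteq> []" using last_branch_of_root[OF b(2), of x] b(3) by auto
    moreover have q: "q x = x" if "x \<in> set xs" for x
      using that b(3) by (auto simp: roots_def)
    ultimately have "branch_of (link q xs) (hd xs) = xs"
      by (intro branch_of_eq branch_link b) auto
    moreover have "?cut (link q xs) xs = q"
      using q by (auto simp: fun_eq_iff link_other)
    ultimately show ?case by (simp add: b)
  next
    case (4 b)
    then obtain q xs where b: "b = (q, xs)" "q \<in> ?F" "set xs = roots V q" "distinct xs"
      by (auto simp: permutations_of_set_def)
    obtain x where "x \<in> V" using ne by blast
    then have xs: "xs \<noteq> []" using last_branch_of_root[OF b(2), of x] b(3) by auto
    then have "hd xs \<in> V" using b(3) hd_in_set[OF xs] by (auto simp: roots_def)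
    \<comment> \<open>Only the last entry remains a root, so the linked forest is a tree.\<close>
    have "set xs - set (butlast xs) = {last xs}"
      using b(4) xs by (cases xs rule: rev_cases) auto
    then show ?case
      using link_in_parent_forests[OF b(2) xs b(4)] b \<open>hd xs \<in> V\<close>
      by (simp add: parent_trees_def)
  next
    case (5 a)
    then show ?case by auto
  qed
  also have "\<dots> = (\<Sum>q\<in>?F. \<Sum>xs\<in>permutations_of_set (roots V q). h xs)"
    using finF by (subst sum.Sigma[symmetric]) auto
  finally show ?thesis .
qed

section \<open>Records and heights counted over forests\<close>

text \<open>With the maximum placed first, the remaining elements can be ordered freely.\<close>

lemma card_permutations_hd_Max:
  fixes S :: "'a::linorder set"
  assumes "finite S" "S \<noteq> {}"
  shows "card {xs \<in> permutations_of_set S. hd xs = Max S} = fact (card S - 1)"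
proof -
  have "{xs \<in> permutations_of_set S. hd xs = Max S}
      = (\<lambda>xs. Max S # xs) ` permutations_of_set (S - {Max S})"
    using assms
    by (subst permutations_of_set_nonempty) (auto intro!: bexI[of _ "Max S"] Max_in)
  then show ?thesis
    using assms by (simp add: card_image)
qed

text \<open>Tree count, total height and record count become factorial sums over forests, which the
  grafting identity relates. The sums are combined additively, so that truncated subtraction causes
  no loss.\<close>

lemma record_count_eq_height_count:
  fixes V :: "'a::linorder set"
  assumes fin: "finite V" and ne: "V \<noteq> {}"
  shows "card V * (\<Sum>p\<in>parent_trees V.
            card {x \<in> V. p x \<noteq> x \<and> Max (set (branch_of p x)) = x})
    = (\<Sum>p\<in>parent_trees V. \<Sum>x\<in>V. length (branch_of p x) - 1)"
proof -
  let ?F = "parent_forests V" and ?f = "\<lambda>q. card (roots V q)"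
  define R where "R = (\<Sum>p\<in>parent_trees V. card {x \<in> V. p x \<noteq> x \<and> Max (set (branch_of p x)) = x})"
  define H where "H = (\<Sum>p\<in>parent_trees V. \<Sum>x\<in>V. length (branch_of p x) - 1)"
  define t where "t = card (parent_trees V)"
  note finF = finite_parent_forests[OF fin]
  have finr: "finite (roots V q)" for q
    using fin by (simp add: roots_def)
  have rne: "roots V q \<noteq> {}" if "q \<in> ?F" for q
    using ne last_branch_of_root[OF that] by auto
  have fpos: "?f q \<ge> 1" if "q \<in> ?F" for q
    using rne[OF that] finr by (simp add: Suc_le_eq card_gt_0_iff)
  have fle: "?f q \<le> card V" for q
    using fin by (intro card_mono) (auto simp: roots_def)

  have t1: "card V * t = (\<Sum>q\<in>?F. fact (?f q))"
    using sum_branches[OF fin ne, of "\<lambda>_. 1::nat"] finr by (simp add: t_def mult.commute)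

  have H1: "H = (\<Sum>q\<in>?F. (?f q - 1) * fact (?f q))"
    unfolding H_def sum_branches[OF fin ne, of "\<lambda>xs. length xs - 1"]
    by (intro sum.cong refl) (simp add: finr length_finite_permutations_of_set mult.commute)

  have root: "length (branch_of p x) = 1 \<longleftrightarrow> p x = x" if "p \<in> ?F" for p x
    using branch_branch_of[OF that, of x] by (cases rule: branch.cases) (auto dest: branch_nonempty)

  \<comment> \<open>\<open>sum_branches\<close> accepts only functions of the branch, so being a
    non-root is expressed by the length and \<open>x\<close> by the head.\<close>
  have "R = (\<Sum>p\<in>parent_trees V. \<Sum>x\<in>V. of_bool (length (branch_of p x) \<noteq> 1
              \<and> hd (branch_of p x) = Max (set (branch_of p x))))"
    unfolding R_def
  proof (intro sum.cong refl)
    fix p assume "p \<in> parent_trees V"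
    then have p: "p \<in> ?F" by (simp add: parent_trees_def)
    have "{x \<in> V. p x \<noteq> x \<and> Max (set (branch_of p x)) = x}
        = {x \<in> V. length (branch_of p x) \<noteq> 1 \<and> hd (branch_of p x) = Max (set (branch_of p x))}"
      using root[OF p] hd_branch[OF branch_branch_of[OF p]] by auto
    then show "card {x \<in> V. p x \<noteq> x \<and> Max (set (branch_of p x)) = x}
        = (\<Sum>x\<in>V. of_bool (length (branch_of p x) \<noteq> 1
              \<and> hd (branch_of p x) = Max (set (branch_of p x))))"
      using fin by (simp add: sum.If_cases of_bool_def Int_def)
  qed
  also have "\<dots> = (\<Sum>q\<in>?F. \<Sum>xs\<in>permutations_of_set (roots V q).
      of_bool (length xs \<noteq> 1 \<and> hd xs = Max (set xs)))"
    by (rule sum_branches[OF fin ne])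
  also have "\<dots> = (\<Sum>q\<in>?F. if ?f q = 1 then 0 else fact (?f q - 1))"
  proof (intro sum.cong refl)
    fix q assume q: "q \<in> ?F"
    have "(\<Sum>xs\<in>permutations_of_set (roots V q). of_bool (length xs \<noteq> 1 \<and> hd xs = Max (set xs)))
        = (\<Sum>xs\<in>permutations_of_set (roots V q). of_bool (?f q \<noteq> 1 \<and> hd xs = Max (roots V q)) :: nat)"
      by (intro sum.cong refl)
        (simp add: length_finite_permutations_of_set permutations_of_setD)
    also have "\<dots> = (if ?f q = 1 then 0 else card {xs \<in> permutations_of_set (roots V q). hd xs = Max (roots V q)})"
      using finr by (simp add: sum.If_cases of_bool_def Int_def)
    finally show "(\<Sum>xs\<in>permutations_of_set (roots V q). of_bool (length xs \<noteq> 1 \<and> hd xs = Max (set xs)))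
        = (if ?f q = 1 then 0 else fact (?f q - 1))"
      using card_permutations_hd_Max[OF finr rne[OF q]] by simp
  qed
  \<comment> \<open>Adding \<open>t\<close> gives each one-root forest the value 1 = 0!, which
    removes the case distinction.\<close>
  finally have "R + t = (\<Sum>q\<in>?F. (if ?f q = 1 then 0 else fact (?f q - 1)) + (if ?f q = 1 then 1 else 0))"
    using finF by (simp add: t_def parent_trees_def sum.distrib sum.If_cases Int_def)
  also have "\<dots> = (\<Sum>q\<in>?F. fact (?f q - 1))"
    by (intro sum.cong refl) auto
  finally have R1: "R + t = (\<Sum>q\<in>?F. fact (?f q - 1))" .

  have P: "(\<Sum>q\<in>?F. card V * (?f q - 1) * fact (?f q - 1))
      = (\<Sum>q\<in>?F. (card V - ?f q) * fact (?f q))"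
    using sum_graft[OF fin, of "\<lambda>m. fact (m - 1) :: nat"] by simp
  \<comment> \<open>For each forest with f roots, (f - 1)! + (f - 1) * (f - 1)! = f!.\<close>
  have "card V * (R + t) + (\<Sum>q\<in>?F. card V * (?f q - 1) * fact (?f q - 1))
      = (\<Sum>q\<in>?F. card V * fact (?f q))"
    unfolding R1 sum_distrib_left sum.distrib[symmetric]
  proof (intro sum.cong refl)
    fix q assume "q \<in> ?F"
    then show "card V * fact (?f q - 1) + card V * (?f q - 1) * fact (?f q - 1) = card V * fact (?f q)"
      using fpos[of q] by (cases "?f q") (auto simp: algebra_simps)
  qed
  also have "\<dots> = (\<Sum>q\<in>?F. (card V - ?f q) * fact (?f q)) + (\<Sum>q\<in>?F. (?f q - 1) * fact (?f q))
      + (\<Sum>q\<in>?F. fact (?f q))"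
    unfolding sum.distrib[symmetric]
  proof (intro sum.cong refl)
    fix q assume "q \<in> ?F"
    \<comment> \<open>The three summands yield the right side of \<open>P\<close>, the total height
      and the tree count; the first and the last cancel.\<close>
    have "card V = (card V - ?f q) + (?f q - 1) + 1"
      using fpos[OF \<open>q \<in> ?F\<close>] fle[of q] by simp
    then show "card V * fact (?f q)
        = (card V - ?f q) * fact (?f q) + (?f q - 1) * fact (?f q) + fact (?f q)"
      by (metis add_mult_distrib mult_1)
  qed
  finally have "card V * R = H"
    unfolding P H1[symmetric] t1[symmetric] by (simp add: algebra_simps)
  then show ?thesis unfolding R_def H_def .
qed

subsection \<open>Undirected trees and parent maps\<close>

text \<open>Roots are fixed points of \<open>p\<close>, so the inequality is what keeps loops
  out.\<close>

definition tree_graph :: "'a set \<Rightarrow> ('a \<Rightarrow> 'a) \<Rightarrow> 'a pair_pre_digraph" where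
  "tree_graph V p =
     \<lparr>pverts = V, parcs = {(x, y). x \<in> V \<and> y \<in> V \<and> x \<noteq> y \<and> (p x = y \<or> p y = x)}\<rparr>"

lemma pverts_tree_graph [simp]: "pverts (tree_graph V p) = V"
  by (simp add: tree_graph_def)

lemma parcs_tree_graph:
  "(x, y) \<in> parcs (tree_graph V p) \<longleftrightarrow> x \<in> V \<and> y \<in> V \<and> x \<noteq> y \<and> (p x = y \<or> p y = x)"
  by (simp add: tree_graph_def)

section \<open>Walks as lists of pairs\<close>

lemma awalk_with_proj_iff:
  "pre_digraph.awalk (with_proj G) u q v \<longleftrightarrow> u \<in> pverts G \<and> set q \<subseteq> parcs G \<and> pcas u q v"
  by (simp add: pre_digraph.awalk_def cas_with_proj_eq)

lemma apath_with_proj_iff: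
  "pre_digraph.apath (with_proj G) u q v \<longleftrightarrow>
     u \<in> pverts G \<and> set q \<subseteq> parcs G \<and> pcas u q v \<and> distinct (pawalk_verts u q)"
  by (auto simp: pre_digraph.apath_def awalk_with_proj_iff awalk_verts_with_proj_eq)

lemma start_in_pawalk_verts: "pcas u q v \<Longrightarrow> u \<in> set (pawalk_verts u q)"
  by (cases q) auto

lemma end_in_pawalk_verts: "pcas u q v \<Longrightarrow> v \<in> set (pawalk_verts u q)"
  by (induction q arbitrary: u) auto

lemma fst_in_pawalk_verts: "e \<in> set q \<Longrightarrow> fst e \<in> set (pawalk_verts u q)"
  by (induction q arbitrary: u) auto

text \<open>Arcs are pairs of vertices, so a walk is determined by its vertex list; uniqueness of
  paths reduces to uniqueness of branches.\<close>

lemma pcas_eq_zip: "pcas u q v \<Longrightarrow> q = zip (pawalk_verts u q) (tl (pawalk_verts u q))"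
proof (induction q arbitrary: u)
  case (Cons e q)
  obtain ys where "pawalk_verts (snd e) q = snd e # ys"
    using Cons.prems by (cases q) auto
  with Cons.IH[of "snd e"] Cons.prems show ?case by (cases e) simp
qed simp

lemma zip_tl_branch:
  assumes "branch p x xs" "x \<in> V" "\<And>y. y \<in> V \<Longrightarrow> p y \<in> V"
  shows "set (zip xs (tl xs)) \<subseteq> parcs (tree_graph V p)
    \<and> pcas x (zip xs (tl xs)) (last xs) \<and> pawalk_verts x (zip xs (tl xs)) = xs"
  using assms(1,2)
proof (induction rule: branch.induct)
  case (step x xs)
  obtain zs where xs: "xs = p x # zs"
    using branch_Cons[OF step.hyps(2)] by blast
  with step assms(3) show ?case by (auto simp: parcs_tree_graph)
qed simp

section \<open>Paths and cycles in the graph of a parent map\<close>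

text \<open>Vertices rather than edges are counted, so a root has depth 1.\<close>

definition depth :: "('a \<Rightarrow> 'a) \<Rightarrow> 'a \<Rightarrow> nat" where
  "depth p x = length (branch_of p x)"

lemma depth_parent:
  assumes "p \<in> parent_forests V" "p x \<noteq> x"
  shows "depth p x = Suc (depth p (p x))"
  using branch_of_eq[OF branch.step[OF assms(2) branch_branch_of[OF assms(1)]]]
  by (simp add: depth_def)

text \<open>A path that has stepped from a parent \<open>u\<close> down to \<open>c\<close> can
  never turn upwards: the only neighbour of \<open>c\<close> that is not a child is
  \<open>u\<close>, which has been visited.\<close>

lemma descending_path:
  assumes p: "p \<in> parent_forests V"
    and "set q \<subseteq> parcs (tree_graph V p)" "pcas c q v" "distinct (u # pawalk_verts c q)"
      "p c = u" "c \<noteq> u"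
  shows "depth p u < depth p v \<and> p v \<noteq> v \<and> last ((u, c) # q) = (p v, v)"
  using assms(2-)
proof (induction q arbitrary: u c)
  case Nil
  then have "v = c" "p c \<noteq> c" by auto
  with Nil depth_parent[OF p, of c] show ?case by simp
next
  case (Cons e q)
  then obtain d where e: "e = (c, d)" by (cases e) auto
  have "d \<in> set (pawalk_verts d q)"
    using Cons.prems(2) start_in_pawalk_verts by (fastforce simp: e)
  then have "d \<noteq> u" using Cons.prems(3) by (auto simp: e)
  moreover have "(c, d) \<in> parcs (tree_graph V p)" using Cons.prems(1) by (simp add: e)
  ultimately have d: "p d = c" "d \<noteq> c" using Cons.prems(4) by (auto simp: parcs_tree_graph)
  have "depth p c < depth p v \<and> p v \<noteq> v \<and> last ((c, d) # q) = (p v, v)"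
    using Cons.prems(1-3) by (intro Cons.IH d) (simp_all add: e)
  then show ?case
    using depth_parent[OF p, of c] Cons.prems(4,5) by (simp add: e)
qed

text \<open>A step down would force the path to end in a non-root, so every step goes to the
  parent.\<close>

lemma path_to_root_is_branch:
  assumes p: "p \<in> parent_forests V"
    and "set q \<subseteq> parcs (tree_graph V p)" "pcas u q v" "distinct (pawalk_verts u q)" "p v = v"
  shows "branch p u (pawalk_verts u q)"
  using assms(2-)
proof (induction q arbitrary: u)
  case Nil
  then show ?case by (auto intro: branch.root)
next
  case (Cons e q)
  then obtain c where e: "e = (u, c)" by (cases e) auto
  have arc: "c \<noteq> u" "p u = c \<or> p c = u"
    using Cons.prems(1) by (auto simp: e parcs_tree_graph)
  have "p c \<noteq> u"
    using descending_path[OF p, of q c v u] Cons.prems arc(1) by (auto simp: e)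
  then have "p u = c" using arc by simp
  moreover have "branch p c (pawalk_verts c q)"
    using Cons.prems by (intro Cons.IH) (simp_all add: e)
  ultimately show ?case
    using branch.step[of p u] arc(1) by (simp add: e)
qed

text \<open>A path first climbs and then descends. Either it descends at the end, or it climbs
  throughout and loses depth.\<close>

lemma last_arc_descends_or_shallower:
  assumes p: "p \<in> parent_forests V"
    and "set q \<subseteq> parcs (tree_graph V p)" "pcas u q v" "distinct (pawalk_verts u q)" "q \<noteq> []"
  shows "last q = (p v, v) \<or> depth p v < depth p u"
  using assms(2-)
proof (induction q arbitrary: u)
  case (Cons e q)
  then obtain c where e: "e = (u, c)" by (cases e) auto
  have arc: "c \<noteq> u" "p u = c \<or> p c = u"
    using Cons.prems(1) by (auto simp: e parcs_tree_graph)
  show ?case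
  proof (cases "p c = u")
    case True
    then show ?thesis
      using descending_path[OF p, of q c v u] Cons.prems arc(1) by (auto simp: e)
  next
    case False
    then have up: "depth p u = Suc (depth p c)"
      using depth_parent[OF p, of u] arc by auto
    show ?thesis
    proof (cases "q = []")
      case True
      then show ?thesis using up Cons.prems(2) by (simp add: e)
    next
      case False
      then have "last q = (p v, v) \<or> depth p v < depth p c"
        using Cons.prems by (intro Cons.IH) (simp_all add: e)
      then show ?thesis using up False by auto
    qed
  qed
qed simp

text \<open>A cycle that starts downwards would return to its start at a greater depth. One that
  starts upwards through \<open>c\<close> must come back down from \<open>c\<close>, and so would
  visit \<open>c\<close> twice.\<close>

lemma no_long_cycle:
  assumes p: "p \<in> parent_forests V"
    and q: "set q \<subseteq> parcs (tree_graph V p)" "pcas u q u" "distinct (tl (pawalk_verts u q))"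
  shows "length q < 3"
proof (rule ccontr)
  assume "\<not> length q < 3"
  then obtain e1 e2 q' where q': "q = e1 # e2 # q'" "q' \<noteq> []"
    by (cases q; cases "tl q") auto
  obtain c d where e: "e1 = (u, c)" "e2 = (c, d)"
    using q(2) by (cases e1; cases e2) (auto simp: q')
  have walk: "pcas d q' u" "distinct (c # pawalk_verts d q')" "set q' \<subseteq> parcs (tree_graph V p)"
    using q by (auto simp: q' e)
  have arc: "c \<noteq> u" "p u = c \<or> p c = u" "d \<noteq> c" "p c = d \<or> p d = c"
    using q(1) by (auto simp: q' e parcs_tree_graph)
  \<comment> \<open>Here the length matters: the rest \<open>q'\<close> is nonempty, so a return to
    \<open>u\<close> after two arcs would repeat \<open>u\<close>.\<close>
  have "d \<noteq> u"
  proof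
    assume "d = u"
    with walk q'(2) show False
      using end_in_pawalk_verts by (cases q') fastforce+
  qed
  show False
  proof (cases "p c = u")
    case True
    then have "p d = c" using arc \<open>d \<noteq> u\<close> by auto
    then have "depth p c < depth p u"
      using descending_path[OF p walk(3,1,2) _ arc(3)] by blast
    then show False using depth_parent[OF p, of c] True arc(1) by simp
  next
    case False
    then have "p u = c" using arc by simp
    then have "\<not> depth p u < depth p c" using depth_parent[OF p, of u] arc(1) by simp
    moreover have "last (e2 # q') = (p u, u) \<or> depth p u < depth p c"
      using q walk by (intro last_arc_descends_or_shallower[OF p]) (simp_all add: q' e)
    ultimately have "last q' = (c, u)" using \<open>p u = c\<close> q'(2) by simp
    then have "(c, u) \<in> set q'" using last_in_set[OF q'(2)] by simp
    then show False using fst_in_pawalk_verts[of "(c, u)" q' d] walk(2) by simp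
  qed
qed

section \<open>From parent maps to rooted trees\<close>

lemma pair_graph_tree_graph: "finite V \<Longrightarrow> pair_graph (tree_graph V p)"
proof
  assume "finite V"
  moreover have "parcs (tree_graph V p) \<subseteq> V \<times> V" by (auto simp: parcs_tree_graph)
  ultimately show "finite (parcs (tree_graph V p))" by (simp add: finite_subset)
  show "symmetric (with_proj (tree_graph V p))"
    by (auto simp: symmetric_def parcs_tree_graph intro!: symI)
qed (auto simp: parcs_tree_graph)

text \<open>Every vertex reaches the root along its branch, and by symmetry the root reaches every
  vertex.\<close>

lemma strongly_connected_tree_graph:
  assumes fin: "finite V" and ne: "V \<noteq> {}" and p: "p \<in> parent_trees V"
  shows "strongly_connected (with_proj (tree_graph V p))"
proof -
  interpret pair_graph "tree_graph V p" using fin by (rule pair_graph_tree_graph)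
  have pF: "p \<in> parent_forests V" and pV: "\<And>y. y \<in> V \<Longrightarrow> p y \<in> V"
    using p by (auto simp: parent_trees_def parent_forests_def)
  obtain r where r: "roots V p = {r}"
    using p by (auto simp: parent_trees_def card_1_singleton_iff)
  have to_r: "x \<rightarrow>\<^sup>*\<^bsub>with_proj (tree_graph V p)\<^esub> r" if "x \<in> V" for x
  proof -
    have "last (branch_of p x) = r" using last_branch_of_root[OF pF that] r by simp
    then have "awalk x (zip (branch_of p x) (tl (branch_of p x))) r"
      using zip_tl_branch[OF branch_branch_of[OF pF] that pV] that
      by (auto simp: awalk_with_proj_iff)
    then show ?thesis by (rule reachable_awalkI)
  qed
  show ?thesis
  proof (rule strongly_connectedI)
    fix u v assume "u \<in> verts (with_proj (tree_graph V p))" "v \<in> verts (with_proj (tree_graph V p))"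
    then have "u \<in> V" "v \<in> V" by simp_all
    then show "u \<rightarrow>\<^sup>*\<^bsub>with_proj (tree_graph V p)\<^esub> v"
      by (intro reachable_trans[OF to_r symmetric_reachable'[OF to_r]])
  qed (use ne in simp)
qed

lemma undirected_tree_tree_graph:
  assumes fin: "finite V" and ne: "V \<noteq> {}" and p: "p \<in> parent_trees V"
  shows "undirected_tree (tree_graph V p)"
proof -
  interpret pair_graph "tree_graph V p" using fin by (rule pair_graph_tree_graph)
  have "connected (with_proj (tree_graph V p))"
    using strongly_connected_tree_graph[OF assms]
    unfolding connected_def strongly_connected_def
    by (simp add: reachable_mk_symmetric_eq[OF sym_arcs])
  moreover have "length q < 3" if "cycle q" for q
    using that no_long_cycle[of p V q] p
    by (auto simp: cycle_def awalk_with_proj_iff parent_trees_def)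
  ultimately show ?thesis
    unfolding undirected_tree_def using pair_graph_tree_graph[OF fin] by (auto simp: not_le)
qed

text \<open>The definite description in \<open>tree_path\<close> is justified here: the branch gives
  a path to the root, and every path to the root follows the branch.\<close>

lemma tree_path_tree_graph:
  assumes p: "p \<in> parent_trees V" and r: "roots V p = {r}" and x: "x \<in> V"
  shows "tree_path (tree_graph V p) x r = zip (branch_of p x) (tl (branch_of p x))"
    and "pawalk_verts x (tree_path (tree_graph V p) x r) = branch_of p x"
proof -
  have pF: "p \<in> parent_forests V" and pV: "\<And>y. y \<in> V \<Longrightarrow> p y \<in> V"
    using p by (auto simp: parent_trees_def parent_forests_def)
  note br = branch_branch_of[OF pF, of x]
  have last: "last (branch_of p x) = r" using last_branch_of_root[OF pF x] r by simp
  note zip = zip_tl_branch[OF br x pV]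
  show eq: "tree_path (tree_graph V p) x r = zip (branch_of p x) (tl (branch_of p x))"
    unfolding tree_path_def
  proof (rule the_equality)
    show "pre_digraph.apath (with_proj (tree_graph V p)) x (zip (branch_of p x) (tl (branch_of p x))) r"
      using zip last x distinct_branch[OF br] by (simp add: apath_with_proj_iff)
  next
    fix q assume "pre_digraph.apath (with_proj (tree_graph V p)) x q r"
    then have q: "set q \<subseteq> parcs (tree_graph V p)" "pcas x q r" "distinct (pawalk_verts x q)"
      by (auto simp: apath_with_proj_iff)
    have "p r = r" using r by (auto simp: roots_def)
    then have "branch_of p x = pawalk_verts x q"
      by (intro branch_of_eq path_to_root_is_branch[OF pF q])
    then show "q = zip (branch_of p x) (tl (branch_of p x))"
      using pcas_eq_zip[OF q(2)] by simp
  qed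
  show "pawalk_verts x (tree_path (tree_graph V p) x r) = branch_of p x"
    using zip eq by simp
qed

section \<open>From rooted trees to parent maps\<close>

text \<open>As parent of a vertex one takes a neighbour closer to \<open>r\<close>. The resulting
  graph is a connected spanning subgraph, and any further edge of \<open>T\<close> would close a
  cycle.\<close>

lemma undirected_tree_is_tree_graph:
  assumes T: "undirected_tree T" and r: "r \<in> pverts T"
  shows "\<exists>p \<in> parent_trees (pverts T). roots (pverts T) p = {r} \<and> T = tree_graph (pverts T) p"
proof -
  interpret pair_graph T using T by (simp add: undirected_tree_def)
  let ?V = "pverts T"
  have "strongly_connected (with_proj T)"
    using T symmetric_connected_imp_strongly_connected[OF sym_arcs] by (simp add: undirected_tree_def)
  then have walk: "\<exists>q. awalk x q r" if "x \<in> ?V" for x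
    using that r by (auto simp: strongly_connected_def reachable_awalk)
  \<comment> \<open>The distance to \<open>r\<close>. The first arc of a shortest walk decreases it,
    which makes the iteration of parents terminate.\<close>
  define D where "D x = (LEAST k. \<exists>q. awalk x q r \<and> length q = k)" for x
  have "\<exists>y. (x, y) \<in> parcs T \<and> D y < D x" if x: "x \<in> ?V" "x \<noteq> r" for x
  proof -
    have "\<exists>k q. awalk x q r \<and> length q = k" using walk[OF x(1)] by blast
    then have "\<exists>q. awalk x q r \<and> length q = D x"
      unfolding D_def by (rule LeastI_ex)
    then obtain q where q: "awalk x q r" "length q = D x" by blast
    then obtain e q' where e: "q = e # q'" using x(2) by (cases q) (auto simp: awalk_Nil_iff)
    then have "awalk (snd e) q' r" "e \<in> parcs T" "fst e = x"
      using q(1) by (auto simp: awalk_Cons_iff)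
    moreover from this(1) have "D (snd e) \<le> length q'"
      unfolding D_def by (intro Least_le) blast
    ultimately show ?thesis using q(2) e by (intro exI[of _ "snd e"]) auto
  qed
  then obtain f where f: "\<And>x. x \<in> ?V \<Longrightarrow> x \<noteq> r \<Longrightarrow> (x, f x) \<in> parcs T \<and> D (f x) < D x"
    by metis
  define p where "p x = (if x \<in> ?V - {r} then f x else x)" for x
  have p_out: "p x = x" if "x \<notin> ?V - {r}" for x
    using that by (auto simp: p_def)
  have p_arc: "(x, p x) \<in> parcs T" and p_D: "D (p x) < D x" if "x \<in> ?V - {r}" for x
    using that f by (auto simp: p_def)
  have "\<exists>xs. branch p x xs" for x
  proof (induction "D x" arbitrary: x rule: less_induct)
    case less
    show ?case
    proof (cases "x \<in> ?V - {r}")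
      case True
      then show ?thesis using less[OF p_D] ex_branch_step by metis
    next
      case False
      then show ?thesis using branch.root[of p x, OF p_out] by blast
    qed
  qed
  moreover have "p x \<in> ?V" if "x \<in> ?V" for x
    using that p_arc[of x] p_out[of x] in_arcsD2 by (cases "x = r") auto
  ultimately have pF: "p \<in> parent_forests ?V"
    using p_out by (auto simp: parent_forests_def)
  have roots: "roots ?V p = {r}"
    using r p_out p_D by (fastforce simp: roots_def)
  with pF have pT: "p \<in> parent_trees ?V" by (simp add: parent_trees_def)
  have sub: "parcs (tree_graph ?V p) \<subseteq> parcs T"
  proof
    fix a assume a: "a \<in> parcs (tree_graph ?V p)"
    obtain x y where xy: "a = (x, y)" by (cases a)
    with a have "x \<in> ?V" "y \<in> ?V" "x \<noteq> y" "p x = y \<or> p y = x"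
      by (auto simp: parcs_tree_graph)
    then have "(x, y) \<in> parcs T \<or> (y, x) \<in> parcs T"
      using p_arc p_out by metis
    then show "a \<in> parcs T" using arcs_symmetric xy by blast
  qed
  have "parcs T \<subseteq> parcs (tree_graph ?V p)"
  proof (rule ccontr)
    assume "\<not> ?thesis"
    then obtain u w where uw: "(u, w) \<in> parcs T" "(u, w) \<notin> parcs (tree_graph ?V p)" by auto
    have V: "u \<in> ?V" "w \<in> ?V" "u \<noteq> w"
      using uw(1) in_arcsD1 in_arcsD2 no_loops' by auto
    interpret P: pair_graph "tree_graph ?V p"
      by (intro pair_graph_tree_graph pair_finite_verts)
    have "w \<rightarrow>\<^sup>*\<^bsub>with_proj (tree_graph ?V p)\<^esub> u"
      using strongly_connected_tree_graph[OF pair_finite_verts _ pT] V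
      by (auto simp: strongly_connected_def)
    then obtain q where "P.apath w q u" unfolding P.reachable_apath by blast
    then have q: "set q \<subseteq> parcs (tree_graph ?V p)" "pcas w q u" "distinct (pawalk_verts w q)"
      by (auto simp: apath_with_proj_iff)
    have "q \<noteq> []" using q(2) V by auto
    \<comment> \<open>A path of one arc would be the supposedly missing edge itself, so the cycle
      closed by \<open>(u, w)\<close> has at least three arcs.\<close>
    moreover have "q \<noteq> [e]" for e
    proof
      assume "q = [e]"
      then have "(w, u) \<in> parcs (tree_graph ?V p)"
        using q(1,2) by (cases e) auto
      then show False using uw(2) by (auto simp: parcs_tree_graph)
    qed
    ultimately have "3 \<le> length ((u, w) # q)" by (cases q; cases "tl q") auto
    moreover have "cycle ((u, w) # q)"
      using q sub uw(1) V by (auto simp: cycle_def awalk_with_proj_iff)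
    ultimately show False using T by (auto simp: undirected_tree_def)
  qed
  with sub have "T = tree_graph ?V p" by (simp add: tree_graph_def)
  with pT roots show ?thesis by blast
qed

lemma parent_of_branch:
  assumes "p \<in> parent_forests V"
  shows "p x = (if tl (branch_of p x) = [] then x else hd (tl (branch_of p x)))"
  using branch_branch_of[OF assms, of x]
proof cases
  case root
  then show ?thesis by (metis list.sel(3))
next
  case (step xs)
  then show ?thesis using branch_nonempty[of p "p x" xs] hd_branch[of p "p x" xs] by simp
qed

lemma bij_betw_rooted_trees:
  assumes "n \<ge> 1"
  shows "bij_betw (\<lambda>p. (tree_graph {1..n} p, the_elem (roots {1..n} p)))
    (parent_trees {1..n}) (rooted_trees n)"
proof -
  let ?V = "{1..n}"
  have root: "\<exists>r \<in> ?V. roots ?V p = {r}" if "p \<in> parent_trees ?V" for p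
    using that by (auto simp: parent_trees_def card_1_singleton_iff roots_def)
  show ?thesis
  proof (rule bij_betw_imageI)
    show "inj_on (\<lambda>p. (tree_graph ?V p, the_elem (roots ?V p))) (parent_trees ?V)"
    proof (rule inj_onI)
      fix p q assume p: "p \<in> parent_trees ?V" and q: "q \<in> parent_trees ?V"
        and eq: "(tree_graph ?V p, the_elem (roots ?V p)) = (tree_graph ?V q, the_elem (roots ?V q))"
      obtain r where r: "roots ?V p = {r}" "roots ?V q = {r}"
        using root[OF p] root[OF q] eq by auto
      have F: "p \<in> parent_forests ?V" "q \<in> parent_forests ?V"
        using p q by (auto simp: parent_trees_def)
      show "p = q"
      proof
        fix x
        show "p x = q x"
        proof (cases "x \<in> ?V")
          case True
          \<comment> \<open>Equal graphs with equal roots have the same paths to the root, and the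
            second entry of a branch, if any, is the parent.\<close>
          then have "branch_of p x = branch_of q x"
            using tree_path_tree_graph(2)[OF p r(1)] tree_path_tree_graph(2)[OF q r(2)] eq by simp
          then show ?thesis
            using parent_of_branch[OF F(1), of x] parent_of_branch[OF F(2), of x] by simp
        next
          case False
          then show ?thesis using F by (simp add: parent_forests_def)
        qed
      qed
    qed
    show "(\<lambda>p. (tree_graph ?V p, the_elem (roots ?V p))) ` parent_trees ?V = rooted_trees n"
    proof (intro equalityI subsetI)
      fix X assume "X \<in> (\<lambda>p. (tree_graph ?V p, the_elem (roots ?V p))) ` parent_trees ?V"
      then obtain p where "p \<in> parent_trees ?V" "X = (tree_graph ?V p, the_elem (roots ?V p))"
        by blast
      then show "X \<in> rooted_trees n"
        using root[of p] undirected_tree_tree_graph[of ?V p] assms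
        by (auto simp: rooted_trees_def)
    next
      fix X assume "X \<in> rooted_trees n"
      then obtain T r where X: "X = (T, r)" "undirected_tree T" "pverts T = ?V" "r \<in> ?V"
        by (auto simp: rooted_trees_def)
      then obtain p where "p \<in> parent_trees ?V" "roots ?V p = {r}" "T = tree_graph ?V p"
        using undirected_tree_is_tree_graph[of T r] by auto
      then show "X \<in> (\<lambda>p. (tree_graph ?V p, the_elem (roots ?V p))) ` parent_trees ?V"
        using X(1) by (intro image_eqI[of _ _ p]) simp_all
    qed
  qed
qed

section \<open>Transfer of the count to rooted trees\<close>

lemma sum_rooted_trees:
  assumes "n \<ge> 1"
    and "\<And>p r. p \<in> parent_trees {1..n} \<Longrightarrow> roots {1..n} p = {r} \<Longrightarrow>
      g (tree_graph {1..n} p) r = h p"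
  shows "(\<Sum>(T, r)\<in>rooted_trees n. g T r) = (\<Sum>p\<in>parent_trees {1..n}. h p)"
proof -
  have "(\<Sum>p\<in>parent_trees {1..n}. h p)
      = (\<Sum>p\<in>parent_trees {1..n}. g (tree_graph {1..n} p) (the_elem (roots {1..n} p)))"
  proof (intro sum.cong refl)
    fix p assume p: "p \<in> parent_trees {1..n}"
    then obtain r where "roots {1..n} p = {r}"
      by (auto simp: parent_trees_def card_1_singleton_iff)
    with assms(2)[OF p this] show "h p = g (tree_graph {1..n} p) (the_elem (roots {1..n} p))"
      by simp
  qed
  also have "\<dots> = (\<Sum>(T, r)\<in>rooted_trees n. g T r)"
    using sum.reindex_bij_betw[OF bij_betw_rooted_trees[OF assms(1)], of "\<lambda>(T, r). g T r"]
    by simp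
  finally show ?thesis by simp
qed

theorem theorem2p2:
  fixes n :: nat
  assumes "n \<ge> 1"
  shows "real (\<Sum>(T, r)\<in>rooted_trees n. card (nonroot_records T r)) = normalized_total_height n"
proof -
  let ?V = "{1..n}"
  have "(\<Sum>(T, r)\<in>rooted_trees n. card (nonroot_records T r))
      = (\<Sum>p\<in>parent_trees ?V. card {x \<in> ?V. p x \<noteq> x \<and> Max (set (branch_of p x)) = x})"
  proof (rule sum_rooted_trees[OF assms])
    fix p r assume p: "p \<in> parent_trees ?V" and r: "roots ?V p = {r}"
    have pF: "p \<in> parent_forests ?V" using p by (simp add: parent_trees_def)
    have "is_record (tree_graph ?V p) r x \<longleftrightarrow> Max (set (branch_of p x)) = x" if x: "x \<in> ?V" for x
    proof -
      have "x \<in> set (branch_of p x)" using branch_Cons[OF branch_branch_of[OF pF, of x]] by auto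
      then have "Max (set (branch_of p x)) = x \<longleftrightarrow> (\<forall>u\<in>set (branch_of p x). u \<le> x)"
        by (subst Max_eq_iff) auto
      then show ?thesis
        using x tree_path_tree_graph(2)[OF p r x]
        by (simp add: is_record_def awalk_verts_with_proj_eq)
    qed
    moreover have "p x \<noteq> x \<longleftrightarrow> x \<noteq> r" if "x \<in> ?V" for x
      using that r by (auto simp: roots_def)
    ultimately have "nonroot_records (tree_graph ?V p) r
        = {x \<in> ?V. p x \<noteq> x \<and> Max (set (branch_of p x)) = x}"
      by (auto simp: nonroot_records_def is_record_def)
    then show "card (nonroot_records (tree_graph ?V p) r)
        = card {x \<in> ?V. p x \<noteq> x \<and> Max (set (branch_of p x)) = x}" by simp
  qed
  \<comment> \<open>A branch lists the vertices of the path, one more than its edges.\<close>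
  moreover have "(\<Sum>(T, r)\<in>rooted_trees n. total_height T r)
      = (\<Sum>p\<in>parent_trees ?V. \<Sum>x\<in>?V. length (branch_of p x) - 1)"
    by (rule sum_rooted_trees[OF assms])
      (simp add: total_height_def height_def tree_path_tree_graph)
  ultimately have "n * (\<Sum>(T, r)\<in>rooted_trees n. card (nonroot_records T r))
      = (\<Sum>(T, r)\<in>rooted_trees n. total_height T r)"
    using record_count_eq_height_count[of ?V] assms by simp
  then have "real n * real (\<Sum>(T, r)\<in>rooted_trees n. card (nonroot_records T r))
      = real (\<Sum>(T, r)\<in>rooted_trees n. total_height T r)"
    by (metis of_nat_mult)
  then show ?thesis
    using assms unfolding normalized_total_height_def by (simp add: field_simps)
qed

end
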